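(* Let $d\ge 2$ be an integer and let $p\in(0,1)$ be constant. Starting from the unit mass $\delta_o$ at the origin $o$ of the lattice $\mathbb{Z}^d$, the minimum number of toppling moves needed to transport mass $p$ to distance at least $n$ from the origin satisfies $$N_p(\mathbb{Z}^d,B_n,\delta_o)=\Theta(n^{d+2}),$$ i.e. there exist constants $0<c\le C<\infty$ and $n_0$, depending only on $d$ and $p$, such that $c\,n^{d+2}\le N_p(\mathbb{Z}^d,B_n,\delta_o)\le C\,n^{d+2}$ for all integers $n\ge n_0$.
   Context: $\mathbb{Z}^d$ is the nearest-neighbour graph on the integer lattice (vertices $x,y$ adjacent iff $\|x-y\|_1=1$). Toppling: let $G=(V,E)$ be a connected, locally finite graph, and write $y\sim v$ when $y,v$ are adjacent and $\mathcal{N}_v=\{y:y\sim v\}$. A mass distribution is a function $\mu:V\to[0,\infty)$. For a vertex $v$ with $\mu(v)>0$ and $0<m\le\mu(v)$, the toppling move $T_v^m$ topples mass $m$ at $v$ equally to its neighbours: $T_v^m\mu=\mu-m\delta_v+\frac{m}{|\mathcal{N}_v|}\sum_{y\sim v}\delta_y$. For $A\subset V$, $p>0$ and an initial mass distribution $\mu_0$, $N_p(G,A,\mu_0)$ is the minimum number of successive toppling moves needed to obtain from $\mu_0$ a mass distribution $\mu$ with $\sum_{v\notin A}\mu(v)\ge p$ (and $\infty$ if this is impossible). $B_n=\{u\in V: d_G(u,o)<n\}$ is the open ball of radius $n$ around $o$ in the graph distance $d_G$. *)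

theory Defs
  imports "HOL-Analysis.Analysis"
begin

text \<open>
  A graph is given by its adjacency relation; its vertex set is the whole type \<^typ>\<open>'v\<close>.
\<close>

definition neighbours :: "('v \<Rightarrow> 'v \<Rightarrow> bool) \<Rightarrow> 'v \<Rightarrow> 'v set" where
  "neighbours adj v = {y. adj v y}"

text \<open>
  The iterate \<^term>\<open>(adj ^^ k) x y\<close> is relational: there is a walk of length \<open>k\<close> from \<open>x\<close> to \<open>y\<close>.
  The infimum of the empty set in \<^typ>\<open>enat\<close> is \<open>\<infinity>\<close>.
\<close>

definition graph_dist :: "('v \<Rightarrow> 'v \<Rightarrow> bool) \<Rightarrow> 'v \<Rightarrow> 'v \<Rightarrow> enat" where
  "graph_dist adj x y = (INF k\<in>{k. (adj ^^ k) x y}. enat k)"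

definition graph_ball :: "('v \<Rightarrow> 'v \<Rightarrow> bool) \<Rightarrow> 'v \<Rightarrow> nat \<Rightarrow> 'v set" where
  "graph_ball adj x n = {u. graph_dist adj u x < enat n}"

definition topple :: "('v \<Rightarrow> 'v \<Rightarrow> bool) \<Rightarrow> 'v \<Rightarrow> real \<Rightarrow> ('v \<Rightarrow> real) \<Rightarrow> 'v \<Rightarrow> real" where
  "topple adj v m \<mu> = (\<lambda>u. \<mu> u - m * indicator {v} u
     + m / real (card (neighbours adj v)) * (\<Sum>y\<in>neighbours adj v. indicator {y} u))"

definition toppling_move :: "('v \<Rightarrow> 'v \<Rightarrow> bool) \<Rightarrow> ('v \<Rightarrow> real) \<Rightarrow> ('v \<Rightarrow> real) \<Rightarrow> bool" where
  "toppling_move adj \<mu> \<mu>' \<longleftrightarrow> (\<exists>v m. 0 < \<mu> v \<and> 0 < m \<and> m \<le> \<mu> v \<and> \<mu>' = topple adj v m \<mu>)"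

text \<open>
  The mass outside \<open>A\<close> is summed in \<^typ>\<open>ennreal\<close>, where every family is summable, so that an
  infinite amount of mass is not read as \<open>0\<close>. The initial distribution \<open>\<mu>\<^sub>0\<close> is meant to be
  nonnegative; toppling moves preserve this on a graph without loops.
\<close>

definition toppling_number ::
  "real \<Rightarrow> ('v \<Rightarrow> 'v \<Rightarrow> bool) \<Rightarrow> 'v set \<Rightarrow> ('v \<Rightarrow> real) \<Rightarrow> enat" where
  "toppling_number p adj A \<mu>\<^sub>0 =
     (INF k\<in>{k. \<exists>\<mu>. (toppling_move adj ^^ k) \<mu>\<^sub>0 \<mu> \<and>
                    (\<Sum>\<^sub>\<infinity>v\<in>- A. ennreal (\<mu> v)) \<ge> ennreal p}. enat k)"

text \<open>The lattice of dimension \<open>d\<close> is \<^typ>\<open>int ^ 'd\<close> with \<open>d = CARD('d)\<close>.\<close>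

definition lattice_adj :: "int ^ 'd \<Rightarrow> int ^ 'd \<Rightarrow> bool" where
  "lattice_adj x y \<longleftrightarrow> (\<Sum>i\<in>UNIV. \<bar>x $ i - y $ i\<bar>) = 1"

lemma lattice_adj_sym: "lattice_adj x y \<longleftrightarrow> lattice_adj y x"
  by (simp add: lattice_adj_def abs_minus_commute)

lemma lattice_adj_irrefl: "\<not> lattice_adj x x"
  by (simp add: lattice_adj_def)

lemma finite_neighbours_lattice: "finite (neighbours lattice_adj (x :: int ^ 'd))"
proof -
  have "y $ i \<in> {x $ i - 1..x $ i + 1}" if "y \<in> neighbours lattice_adj x" for y i
  proof -
    have "\<bar>x $ i - y $ i\<bar> \<le> (\<Sum>i\<in>UNIV. \<bar>x $ i - y $ i\<bar>)"
      by (rule member_le_sum) auto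
    with that show ?thesis by (auto simp: neighbours_def lattice_adj_def)
  qed
  then have "vec_nth ` neighbours lattice_adj x \<subseteq> (\<Pi>\<^sub>E i\<in>UNIV. {x $ i - 1..x $ i + 1})"
    by (intro image_subsetI PiE_I) simp_all
  then have "finite (vec_nth ` neighbours lattice_adj x)"
    by (rule finite_subset) (auto intro: finite_PiE)
  then show ?thesis
    by (rule finite_imageD) (simp add: inj_on_def vec_nth_inject)
qed

end

theory Submission imports Defs begin

text \<open>
  Upper bound: always topple all the mass at a vertex of the ball \<open>B\<close> that carries the most mass.
  While more than \<open>1 - p\<close> of the mass is in \<open>B\<close>, such a move transports at least
  \<open>(1 - p) / |B|\<close>, and it raises the second moment by the amount toppled. The second moment stays
  below \<open>n\<^sup>2\<close>, so at most about \<open>n\<^sup>2 |B| / (1 - p)\<close> moves are made.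

  Lower bound: let \<open>u\<close> be the odometer (total mass toppled at each vertex) and \<open>P\<close> the walk operator,
  so that the current mass is \<open>\<mu> = \<delta>\<^sub>o + (P - 1) u\<close>. Compare with the odometer
  \<open>w = \<Sum>s<t. P\<^sup>s \<delta>\<^sub>o\<close> of the walk run for \<open>t \<approx> p n\<^sup>2 / (2 d)\<close> steps, which spreads the mass to
  \<open>\<nu> = P\<^sup>t \<delta>\<^sub>o \<le> M = O(n\<^sup>-\<^sup>d)\<close>. For \<open>g = max 0 (u - w)\<close> the quantity \<open>\<langle>g, 2 \<nu> + (P - 1) g - 4 M\<rangle>\<close>
  decreases by at most \<open>4 M\<^sup>2\<close> per move, whereas it is at most \<open>- 2 M \<Sum>g\<close>; hence after \<open>k\<close> moves
  \<open>\<Sum>u - t \<le> \<Sum>g \<le> 2 M k\<close>. The second moment shows \<open>\<Sum>u \<ge> p n\<^sup>2 / d\<close>, and \<open>k \<ge> c n\<^bsup>d+2\<^esup>\<close> follows.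
\<close>

lemma relpowp_Suc_cases:
  assumes "(R ^^ Suc k) x z"
  obtains y where "(R ^^ k) x y" "R y z"
  using assms by auto

section \<open>Toppling on regular graphs\<close>

locale regular_graph =
  fixes adj :: "'v \<Rightarrow> 'v \<Rightarrow> bool" and D :: nat
  assumes sym: "adj x y \<longleftrightarrow> adj y x"
    and finite_nbs: "finite (neighbours adj x)"
    and card_nbs: "card (neighbours adj x) = D"
    and D_pos: "0 < D"
begin

section \<open>The averaging operator: symmetry, contraction, and its link to toppling\<close>

definition avg :: "('v \<Rightarrow> real) \<Rightarrow> 'v \<Rightarrow> real" where
  "avg f x = (\<Sum>y\<in>neighbours adj x. f y) / D"

lemma avg_add: "avg (\<lambda>x. f x + g x) x = avg f x + avg g x"
  by (simp add: avg_def sum.distrib add_divide_distrib)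

lemma avg_cmult: "avg (\<lambda>x. c * f x) x = c * avg f x"
  by (simp add: avg_def sum_distrib_left)

lemma avg_sum: "avg (\<lambda>x. \<Sum>i\<in>I. f i x) x = (\<Sum>i\<in>I. avg (f i) x)"
  by (simp add: avg_def sum.swap[of _ I] sum_divide_distrib)

lemma avg_mono: "(\<And>y. f y \<le> g y) \<Longrightarrow> avg f x \<le> avg g x"
  by (simp add: avg_def divide_right_mono sum_mono)

lemma avg_nonneg: "(\<And>y. 0 \<le> f y) \<Longrightarrow> 0 \<le> avg f x"
  by (simp add: avg_def sum_nonneg)

lemma avg_const: "avg (\<lambda>_. c) x = c"
  using D_pos by (simp add: avg_def card_nbs)

lemma avg_indicator: "avg (indicator {v}) x = (if adj x v then 1 / D else 0)"
proof -
  have "(\<Sum>y\<in>neighbours adj x. indicator {v} y :: real) = (\<Sum>y\<in>neighbours adj x. if y = v then 1 else 0)"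
    by (intro sum.cong) auto
  then show ?thesis
    by (simp only: avg_def sum.delta[OF finite_nbs]) (simp add: neighbours_def)
qed

text \<open>On a symmetric graph of constant degree the walk operator is symmetric, so the mass sent
  from \<open>v\<close> to \<open>x\<close> can be read as an average taken at \<open>x\<close>. A
  move thus adds \<open>m\<close> times (P - 1) applied to the point mass at
  \<open>v\<close>.\<close>

lemma topple_conv_avg:
  "topple adj v m \<mu> x = \<mu> x + m * (avg (indicator {v}) x - indicator {v} x)"
proof -
  have "(\<Sum>y\<in>neighbours adj v. indicator {y} x :: real) = (if adj v x then 1 else 0)"
  proof -
    have "(\<Sum>y\<in>neighbours adj v. indicator {y} x :: real) = (\<Sum>y\<in>neighbours adj v. if y = x then 1 else 0)"
      by (intro sum.cong) auto
    also have "\<dots> = (if adj v x then 1 else 0)"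
      by (simp only: sum.delta[OF finite_nbs]) (simp add: neighbours_def)
    finally show ?thesis .
  qed
  then show ?thesis
    by (simp add: topple_def avg_indicator card_nbs sym[of v x] algebra_simps)
qed

text \<open>As a sum over ordered pairs in \<open>S\<close>, the bilinear form of \<open>avg\<close>
  can be handled edge by edge. Only \<open>g\<close> has to vanish off \<open>S\<close>, since
  \<open>f\<close> is evaluated on \<open>S\<close> alone.\<close>

lemma avg_double_sum:
  assumes "finite S" "\<And>x. x \<notin> S \<Longrightarrow> g x = 0"
  shows "(\<Sum>x\<in>S. f x * avg g x) = (\<Sum>x\<in>S. \<Sum>y\<in>S. (if adj x y then f x * g y / D else 0))"
proof (rule sum.cong[OF refl])
  fix x assume "x \<in> S"
  have "(\<Sum>y\<in>neighbours adj x. g y) = (\<Sum>y\<in>S \<inter> neighbours adj x. g y)"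
    by (rule sum.mono_neutral_right) (use assms finite_nbs in auto)
  also have "\<dots> = (\<Sum>y\<in>S. if adj x y then g y else 0)"
    using assms(1) by (simp add: sum.inter_restrict neighbours_def)
  finally have "f x * avg g x = (\<Sum>y\<in>S. f x / D * (if adj x y then g y else 0))"
    by (simp add: avg_def sum_distrib_left sum_divide_distrib)
  also have "\<dots> = (\<Sum>y\<in>S. (if adj x y then f x * g y / D else 0))"
    by (rule sum.cong) auto
  finally show "f x * avg g x = \<dots>" .
qed

lemma avg_symmetric:
  assumes "finite S" "\<And>x. x \<notin> S \<Longrightarrow> f x = 0" "\<And>x. x \<notin> S \<Longrightarrow> g x = 0"
  shows "(\<Sum>x\<in>S. f x * avg g x) = (\<Sum>x\<in>S. g x * avg f x)"
proof -
  have "(\<Sum>x\<in>S. f x * avg g x) = (\<Sum>x\<in>S. \<Sum>y\<in>S. (if adj x y then f x * g y / D else 0))"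
    using assms by (simp add: avg_double_sum)
  also have "\<dots> = (\<Sum>x\<in>S. \<Sum>y\<in>S. (if adj x y then g x * f y / D else 0))"
    by (subst sum.swap) (intro sum.cong refl if_cong; simp add: sym mult.commute)
  also have "\<dots> = (\<Sum>x\<in>S. g x * avg f x)"
    using assms by (simp add: avg_double_sum)
  finally show ?thesis .
qed

text \<open>Here \<open>\<phi>\<close> may be unbounded, as the squared norm is. It is cut off
  outside \<open>S\<close>, which goes unnoticed because \<open>S\<close> contains all neighbours of
  the support of \<open>u\<close>.\<close>

lemma avg_summation_by_parts:
  assumes "finite S" "\<And>x. x \<notin> S \<Longrightarrow> u x = 0"
    and nbs: "\<And>x. u x \<noteq> 0 \<Longrightarrow> neighbours adj x \<subseteq> S"
  shows "(\<Sum>x\<in>S. \<phi> x * avg u x) = (\<Sum>x\<in>S. u x * avg \<phi> x)"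
proof -
  let ?\<psi> = "\<lambda>x. if x \<in> S then \<phi> x else 0"
  have "(\<Sum>x\<in>S. \<phi> x * avg u x) = (\<Sum>x\<in>S. ?\<psi> x * avg u x)"
    by simp
  also have "\<dots> = (\<Sum>x\<in>S. u x * avg ?\<psi> x)"
    by (rule avg_symmetric) (use assms in auto)
  also have "\<dots> = (\<Sum>x\<in>S. u x * avg \<phi> x)"
  proof (rule sum.cong[OF refl])
    show "u x * avg ?\<psi> x = u x * avg \<phi> x" for x
      by (cases "u x = 0") (use nbs[of x] in \<open>auto simp: avg_def subset_iff\<close>)
  qed
  finally show ?thesis .
qed

text \<open>P is a contraction: apply the inequality of arithmetic and geometric means to each pair
  of neighbours, then use that each vertex has at most \<open>D\<close> neighbours in
  \<open>S\<close>.\<close>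

lemma avg_quadratic_le:
  assumes "finite S" "\<And>x. x \<notin> S \<Longrightarrow> g x = 0"
  shows "(\<Sum>x\<in>S. g x * avg g x) \<le> (\<Sum>x\<in>S. g x * g x)"
proof -
  let ?\<chi> = "\<lambda>x. if x \<in> S then 1 else 0 :: real"
  let ?h = "\<lambda>x. g x * g x"
  have am: "g x * g y / D \<le> (?h x / D + ?h y / D) / 2" for x y
  proof -
    have "2 * (g x * g y) \<le> ?h x + ?h y"
      using sum_squares_bound[of "g x" "g y"] by (simp add: power2_eq_square mult.assoc)
    then show ?thesis using D_pos by (simp add: field_simps)
  qed
  have "(\<Sum>x\<in>S. g x * avg g x) = (\<Sum>x\<in>S. \<Sum>y\<in>S. (if adj x y then g x * g y / D else 0))"
    using assms by (simp add: avg_double_sum)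
  also have "\<dots> \<le> (\<Sum>x\<in>S. \<Sum>y\<in>S. ((if adj x y then ?h x * ?\<chi> y / D else 0)
      + (if adj x y then ?\<chi> x * ?h y / D else 0)) / 2)"
    by (intro sum_mono) (use am in auto)
  also have "\<dots> = ((\<Sum>x\<in>S. ?h x * avg ?\<chi> x) + (\<Sum>x\<in>S. ?\<chi> x * avg ?h x)) / 2"
  proof -
    have "(\<Sum>x\<in>S. ?h x * avg ?\<chi> x) = (\<Sum>x\<in>S. \<Sum>y\<in>S. if adj x y then ?h x * ?\<chi> y / D else 0)"
      by (rule avg_double_sum) (use assms in auto)
    moreover have "(\<Sum>x\<in>S. ?\<chi> x * avg ?h x) = (\<Sum>x\<in>S. \<Sum>y\<in>S. if adj x y then ?\<chi> x * ?h y / D else 0)"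
      by (rule avg_double_sum) (use assms in auto)
    ultimately show ?thesis
      by (simp only: sum.distrib sum_divide_distrib[symmetric])
  qed
  also have "(\<Sum>x\<in>S. ?\<chi> x * avg ?h x) = (\<Sum>x\<in>S. ?h x * avg ?\<chi> x)"
    using assms by (intro avg_symmetric) auto
  also have "((\<Sum>x\<in>S. ?h x * avg ?\<chi> x) + (\<Sum>x\<in>S. ?h x * avg ?\<chi> x)) / 2
      = (\<Sum>x\<in>S. ?h x * avg ?\<chi> x)"
    by simp
  also have "\<dots> \<le> (\<Sum>x\<in>S. ?h x * 1)"
  proof (intro sum_mono mult_left_mono)
    fix x
    show "avg ?\<chi> x \<le> 1"
      using avg_mono[of ?\<chi> "\<lambda>_. 1" x] by (simp add: avg_const)
  qed simp
  finally show ?thesis by simp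
qed

text \<open>With \<open>\<phi>\<close> constant this is conservation of mass; with (P - 1)
  \<open>\<phi>\<close> = 1 it says that the moment grows by exactly the mass toppled.\<close>

lemma sum_topple:
  assumes "finite S" "v \<in> S" "neighbours adj v \<subseteq> S"
  shows "(\<Sum>x\<in>S. \<phi> x * topple adj v m \<mu> x) = (\<Sum>x\<in>S. \<phi> x * \<mu> x) + m * (avg \<phi> v - \<phi> v)"
proof -
  have 1: "(\<Sum>x\<in>S. \<phi> x * avg (indicator {v}) x) = avg \<phi> v"
  proof -
    have "(\<Sum>x\<in>S. \<phi> x * avg (indicator {v}) x) = (\<Sum>x\<in>S. indicator {v} x * avg \<phi> x)"
      by (rule avg_summation_by_parts) (use assms in \<open>auto simp: indicator_def split: if_splits\<close>)
    then show ?thesis using assms by (simp add: indicator_def)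
  qed
  have 2: "(\<Sum>x\<in>S. \<phi> x * indicator {v} x) = \<phi> v"
    using assms by (simp add: indicator_def)
  have "(\<Sum>x\<in>S. \<phi> x * topple adj v m \<mu> x)
      = (\<Sum>x\<in>S. \<phi> x * \<mu> x + m * (\<phi> x * avg (indicator {v}) x) - m * (\<phi> x * indicator {v} x))"
    by (intro sum.cong refl) (simp add: topple_conv_avg algebra_simps)
  also have "\<dots> = (\<Sum>x\<in>S. \<phi> x * \<mu> x) + m * (avg \<phi> v - \<phi> v)"
    by (simp only: sum.distrib sum_subtractf sum_distrib_left[symmetric] 1 2) (simp add: algebra_simps)
  finally show ?thesis .
qed

lemma toppling_move_nonneg:
  assumes "toppling_move adj \<mu> \<mu>'" "\<And>x. 0 \<le> \<mu> x"
  shows "0 \<le> \<mu>' x"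
proof -
  obtain v m where vm: "0 < m" "m \<le> \<mu> v" "\<mu>' = topple adj v m \<mu>"
    using assms(1) by (auto simp: toppling_move_def)
  have "0 \<le> avg (indicator {v}) x"
    by (rule avg_nonneg) simp
  then have "0 \<le> m * avg (indicator {v}) x"
    using vm by simp
  then show ?thesis
    using vm assms(2)[of x] by (cases "x = v") (auto simp: topple_conv_avg algebra_simps)
qed

section \<open>Odometers, their comparison with a reference process, and greedy toppling\<close>

definition odometer :: "('v \<Rightarrow> real) \<Rightarrow> ('v \<Rightarrow> real) \<Rightarrow> ('v \<Rightarrow> real) \<Rightarrow> bool" where
  "odometer \<sigma> \<mu> u \<longleftrightarrow> (\<forall>x. 0 \<le> u x) \<and> finite {x. u x \<noteq> 0} \<and> (\<forall>x. \<mu> x = \<sigma> x + avg u x - u x)"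

text \<open>The terms \<open>2 * \<nu> x + avg g x - g x\<close> make up the usual quadratic energy, which gains at least
  \<open>m\<^sup>2\<close> from a move of mass \<open>m\<close>; the shift by \<open>4 * M\<close> linearises the Cauchy-Schwarz inequality
  between the sums of \<open>m\<close> and of \<open>m\<^sup>2\<close> over all moves.\<close>

definition energy :: "('v \<Rightarrow> real) \<Rightarrow> real \<Rightarrow> 'v set \<Rightarrow> ('v \<Rightarrow> real) \<Rightarrow> real" where
  "energy \<nu> M S g = (\<Sum>x\<in>S. g x * (2 * \<nu> x + avg g x - g x - 4 * M))"

text \<open>Exact expansion of a quadratic form: by symmetry of P the two cross terms coincide,
  which produces the factor 2 in front of \<open>avg g v\<close>.\<close>

lemma energy_add_indicator:
  assumes S: "finite S" "v \<in> S" "\<And>x. x \<notin> S \<Longrightarrow> g x = 0"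
  shows "energy \<nu> M S (\<lambda>x. g x + m * indicator {v} x)
    = energy \<nu> M S g + 2 * m * (\<nu> v + avg g v - g v) + m\<^sup>2 * (avg (indicator {v}) v - 1) - 4 * M * m"
proof -
  let ?i = "indicator {v} :: 'v \<Rightarrow> real"
  have sym: "(\<Sum>x\<in>S. g x * avg ?i x) = (\<Sum>x\<in>S. ?i x * avg g x)"
    by (rule avg_symmetric) (use S in \<open>auto simp: indicator_def\<close>)
  have i: "(\<Sum>x\<in>S. ?i x * f x) = f v" for f :: "'v \<Rightarrow> real"
    using S by (simp add: indicator_def)
  have "energy \<nu> M S (\<lambda>x. g x + m * ?i x)
     = (\<Sum>x\<in>S. g x * (2 * \<nu> x + avg g x - g x - 4 * M) + m * (g x * avg ?i x)
        + m * (?i x * (2 * \<nu> x + avg g x - 2 * g x - 4 * M + m * avg ?i x - m * ?i x)))"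
    unfolding energy_def by (intro sum.cong refl) (simp add: avg_add avg_cmult algebra_simps)
  also have "\<dots> = energy \<nu> M S g + m * avg g v
      + m * (2 * \<nu> v + avg g v - 2 * g v - 4 * M + m * avg ?i v - m * ?i v)"
    by (simp only: sum.distrib sum_distrib_left[symmetric] sym i energy_def)
  finally show ?thesis by (simp add: algebra_simps power2_eq_square)
qed

text \<open>Once the odometer exceeds \<open>w\<close> at a vertex, toppling there is legal also for the process
  that starts from \<open>\<nu>\<close> with odometer \<open>w\<close>, because that process has odometer \<open>max u w \<ge> u\<close>.\<close>

lemma odometer_energy:
  assumes w: "\<And>x. 0 \<le> w x" and \<nu>: "\<And>x. \<nu> x = \<sigma> x + avg w x - w x"
    and \<sigma>: "\<And>x. 0 \<le> \<sigma> x"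
    and moves: "(toppling_move adj ^^ k) \<sigma> \<mu>"
  shows "\<exists>u. odometer \<sigma> \<mu> u \<and> (\<forall>x. 0 \<le> \<mu> x) \<and>
    (\<forall>S. finite S \<longrightarrow> {x. u x \<noteq> 0} \<subseteq> S \<longrightarrow>
       - (4 * M\<^sup>2 * k) \<le> energy \<nu> M S (\<lambda>x. max 0 (u x - w x)))"
  using moves
proof (induction k arbitrary: \<mu>)
  case 0
  have "odometer \<sigma> \<mu> (\<lambda>_. 0)"
    using 0 by (simp add: odometer_def avg_const)
  moreover have "energy \<nu> M S (\<lambda>x. max 0 (0 - w x)) = 0" for S
    using w by (simp add: energy_def max_absorb1)
  ultimately show ?case using 0 \<sigma> by (intro exI[of _ "\<lambda>_. 0"]) auto
next
  case (Suc k)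
  obtain \<mu>' where \<mu>': "(toppling_move adj ^^ k) \<sigma> \<mu>'" "toppling_move adj \<mu>' \<mu>"
    using Suc.prems by (rule relpowp_Suc_cases)
  obtain u where u: "odometer \<sigma> \<mu>' u" "\<And>x. 0 \<le> \<mu>' x"
    and en: "\<And>S. finite S \<Longrightarrow> {x. u x \<noteq> 0} \<subseteq> S \<Longrightarrow>
       - (4 * M\<^sup>2 * k) \<le> energy \<nu> M S (\<lambda>x. max 0 (u x - w x))"
    using Suc.IH[OF \<mu>'(1)] by blast
  obtain v m where vm: "0 < m" "m \<le> \<mu>' v" "\<mu> = topple adj v m \<mu>'"
    using \<mu>'(2) by (auto simp: toppling_move_def)
  define u' where "u' = (\<lambda>x. u x + m * indicator {v} x)"
  have "odometer \<sigma> \<mu> u'"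
    unfolding odometer_def
  proof (intro conjI allI)
    show "0 \<le> u' x" for x using u(1) vm(1) by (simp add: u'_def odometer_def)
    have "{x. u' x \<noteq> 0} \<subseteq> insert v {x. u x \<noteq> 0}"
      by (auto simp: u'_def)
    then show "finite {x. u' x \<noteq> 0}"
      using u(1) finite_subset by (auto simp: odometer_def)
    show "\<mu> x = \<sigma> x + avg u' x - u' x" for x
      using u(1) by (simp add: vm(3) topple_conv_avg odometer_def u'_def avg_add avg_cmult algebra_simps)
  qed
  moreover have "0 \<le> \<mu> x" for x
    by (rule toppling_move_nonneg[OF \<mu>'(2) u(2)])
  moreover have "- (4 * M\<^sup>2 * Suc k) \<le> energy \<nu> M S (\<lambda>x. max 0 (u' x - w x))"
    if S: "finite S" "{x. u' x \<noteq> 0} \<subseteq> S" for S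
  proof -
    define g where "g = (\<lambda>x. max 0 (u x - w x))"
    \<comment> \<open>Only the part of the move that lies above \<open>w\<close> changes
      \<open>g\<close>; it may be anything between 0 and \<open>m\<close>.\<close>
    define m' where "m' = max 0 (u' v - w v) - g v"
    have upos: "0 \<le> u x" for x using u(1) by (simp add: odometer_def)
    have vS: "v \<in> S" using S(2) vm(1) upos[of v] by (auto simp: u'_def)
    have uS: "{x. u x \<noteq> 0} \<subseteq> S"
    proof
      fix x assume "x \<in> {x. u x \<noteq> 0}"
      then have "u' x \<noteq> 0" using upos[of x] vm(1) by (auto simp: u'_def indicator_def)
      then show "x \<in> S" using S(2) by auto
    qed
    have gS: "g x = 0" if "x \<notin> S" for x
    proof -
      have "u x = 0" using uS that by auto
      then show ?thesis using w[of x] by (simp add: g_def)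
    qed
    have g': "(\<lambda>x. max 0 (u' x - w x)) = (\<lambda>x. g x + m' * indicator {v} x)"
      by (auto simp: m'_def g_def u'_def indicator_def)
    have m'0: "0 \<le> m'" using vm(1) by (auto simp: m'_def g_def u'_def)
    \<comment> \<open>If \<open>m'\<close> is positive, then \<open>g v + m' = u' v - w v\<close>.
      Legality of the original move gives \<open>u' v \<le> \<sigma> v + avg u v\<close>, and
      \<open>u \<le> w + g\<close> bounds the average.\<close>
    have legal: "m' * m' \<le> m' * (\<nu> v + avg g v - g v)"
    proof (cases "m' = 0")
      case False
      then have "g v + m' = u' v - w v"
        using m'0 by (auto simp: m'_def g_def max_def split: if_splits)
      moreover have "avg u v \<le> avg (\<lambda>x. w x + g x) v"
        by (rule avg_mono) (simp add: g_def)
      moreover have "\<mu>' v = \<sigma> v + avg u v - u v"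
        using u(1) by (simp add: odometer_def)
      ultimately have "m' \<le> \<nu> v + avg g v - g v"
        using vm(2) by (simp add: \<nu> avg_add u'_def)
      then show ?thesis using m'0 by (rule mult_left_mono)
    qed simp
    have i: "0 \<le> m'\<^sup>2 * avg (indicator {v}) v"
      by (intro mult_nonneg_nonneg avg_nonneg) auto
    \<comment> \<open>By \<open>legal\<close> and \<open>i\<close>, the energy changes by at least
      \<open>m' * m' - 4 * M * m'\<close>; completing the square bounds the loss independently of
      the size of the move.\<close>
    have sq: "4 * M * m' - m' * m' \<le> 4 * M\<^sup>2"
      using zero_le_power2[of "2 * M - m'"] by (simp add: power2_eq_square algebra_simps)
    have "- (4 * M\<^sup>2 * k) \<le> energy \<nu> M S g"
      unfolding g_def by (rule en[OF S(1) uS])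
    moreover have "energy \<nu> M S (\<lambda>x. g x + m' * indicator {v} x) = energy \<nu> M S g
        + 2 * m' * (\<nu> v + avg g v - g v) + m'\<^sup>2 * (avg (indicator {v}) v - 1) - 4 * M * m'"
      by (rule energy_add_indicator[OF S(1) vS gS])
    ultimately show ?thesis
      unfolding g' using legal i sq by (simp add: algebra_simps power2_eq_square)
  qed
  ultimately show ?case by blast
qed

text \<open>The quadratic part of the energy is at most 0 by contraction and
  \<open>\<nu> \<le> M\<close> controls the linear part, so the accumulated energy loss limits the
  sum of \<open>g\<close>. The set \<open>S\<close> stays free because the moment identity chooses
  it later.\<close>

theorem odometer_excess_le:
  assumes w: "\<And>x. 0 \<le> w x" and \<nu>: "\<And>x. \<nu> x = \<sigma> x + avg w x - w x" "\<And>x. \<nu> x \<le> M"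
    and \<sigma>: "\<And>x. 0 \<le> \<sigma> x" and M: "0 < M"
    and moves: "(toppling_move adj ^^ k) \<sigma> \<mu>"
  obtains u where "odometer \<sigma> \<mu> u" "\<And>x. 0 \<le> \<mu> x"
    "\<And>S. finite S \<Longrightarrow> {x. u x \<noteq> 0} \<subseteq> S \<Longrightarrow> (\<Sum>x\<in>S. u x) \<le> 2 * M * k + (\<Sum>x\<in>S. w x)"
proof -
  obtain u where u: "odometer \<sigma> \<mu> u" "\<forall>x. 0 \<le> \<mu> x"
    and en: "\<And>S. finite S \<Longrightarrow> {x. u x \<noteq> 0} \<subseteq> S \<Longrightarrow>
       - (4 * M\<^sup>2 * k) \<le> energy \<nu> M S (\<lambda>x. max 0 (u x - w x))"
    using odometer_energy[OF w \<nu>(1) \<sigma> moves] by blast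
  have "(\<Sum>x\<in>S. u x) \<le> 2 * M * k + (\<Sum>x\<in>S. w x)" if S: "finite S" "{x. u x \<noteq> 0} \<subseteq> S" for S
  proof -
    define g where "g = (\<lambda>x. max 0 (u x - w x))"
    have gS: "g x = 0" if "x \<notin> S" for x
    proof -
      have "u x = 0" using S(2) that by auto
      then show ?thesis using w[of x] by (simp add: g_def)
    qed
    have "energy \<nu> M S g
        = (\<Sum>x\<in>S. g x * (2 * \<nu> x - 4 * M)) + ((\<Sum>x\<in>S. g x * avg g x) - (\<Sum>x\<in>S. g x * g x))"
      by (simp add: energy_def algebra_simps flip: sum.distrib sum_subtractf)
    also have "\<dots> \<le> (\<Sum>x\<in>S. g x * (2 * \<nu> x - 4 * M))"
      using avg_quadratic_le[of S g, OF S(1) gS] by simp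
    also have "\<dots> \<le> (\<Sum>x\<in>S. g x * (- 2 * M))"
      using \<nu>(2) by (intro sum_mono mult_left_mono) (auto simp: g_def)
    also have "\<dots> = - 2 * M * (\<Sum>x\<in>S. g x)"
      by (simp add: sum_distrib_right sum_negf mult.commute)
    finally have "2 * M * (\<Sum>x\<in>S. g x) \<le> 2 * M * (2 * M * k)"
      using en[OF S] by (simp add: g_def power2_eq_square)
    then have "(\<Sum>x\<in>S. g x) \<le> 2 * M * k"
      using M by simp
    moreover have "(\<Sum>x\<in>S. u x) \<le> (\<Sum>x\<in>S. g x + w x)"
      by (intro sum_mono) (simp add: g_def)
    ultimately show ?thesis by (simp add: sum.distrib)
  qed
  then show ?thesis using that u by blast
qed

text \<open>Summation by parts moves P - 1 from \<open>u\<close> to \<open>\<phi>\<close>, where it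
  gives 1. Including the neighbours of the support of \<open>u\<close> in \<open>S\<close> removes
  boundary terms and leaves \<open>\<mu>\<close> equal to \<open>\<sigma>\<close> outside.\<close>

lemma odometer_moment:
  assumes u: "odometer \<sigma> \<mu> u" and \<phi>: "\<And>x. avg \<phi> x = \<phi> x + 1" and A: "finite A"
  obtains S where "finite S" "A \<subseteq> S" "{x. u x \<noteq> 0} \<subseteq> S" "\<And>x. x \<notin> S \<Longrightarrow> \<mu> x = \<sigma> x"
    "(\<Sum>x\<in>S. \<phi> x * \<mu> x) = (\<Sum>x\<in>S. \<phi> x * \<sigma> x) + (\<Sum>x\<in>S. u x)"
proof -
  define X where "X = {x. u x \<noteq> 0}"
  define S where "S = A \<union> X \<union> (\<Union>x\<in>X. neighbours adj x)"
  have fin: "finite S"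
    using u A by (auto simp: S_def X_def odometer_def finite_nbs)
  have 1: "(\<Sum>x\<in>S. \<phi> x * avg u x) = (\<Sum>x\<in>S. u x * avg \<phi> x)"
    by (rule avg_summation_by_parts[OF fin]) (auto simp: S_def X_def)
  have "(\<Sum>x\<in>S. \<phi> x * \<mu> x) = (\<Sum>x\<in>S. \<phi> x * \<sigma> x) + ((\<Sum>x\<in>S. \<phi> x * avg u x) - (\<Sum>x\<in>S. \<phi> x * u x))"
  proof -
    have "\<mu> = (\<lambda>x. \<sigma> x + avg u x - u x)" using u by (auto simp: odometer_def)
    then show ?thesis by (simp add: ring_distribs sum.distrib sum_subtractf)
  qed
  also have "(\<Sum>x\<in>S. \<phi> x * avg u x) - (\<Sum>x\<in>S. \<phi> x * u x) = (\<Sum>x\<in>S. u x)"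
    unfolding 1 by (simp add: \<phi> algebra_simps flip: sum_subtractf)
  finally have "(\<Sum>x\<in>S. \<phi> x * \<mu> x) = (\<Sum>x\<in>S. \<phi> x * \<sigma> x) + (\<Sum>x\<in>S. u x)" .
  moreover have "\<mu> x = \<sigma> x" if "x \<notin> S" for x
  proof -
    have "u x = 0" using that by (auto simp: S_def X_def)
    moreover have "u y = 0" if "y \<in> neighbours adj x" for y
      using that \<open>x \<notin> S\<close> sym by (auto simp: S_def X_def neighbours_def)
    ultimately show ?thesis using u by (simp add: odometer_def avg_def)
  qed
  moreover have "A \<subseteq> S" "{x. u x \<noteq> 0} \<subseteq> S" by (auto simp: S_def X_def)
  ultimately show ?thesis using that fin by blast
qed

text \<open>Induction on the number of moves: either the target was reached at some stage, or one
  more greedy move is possible. Mass never leaves \<open>S\<close>, since only vertices of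
  \<open>B\<close> topple.\<close>

lemma greedy_toppling:
  assumes B: "finite B" and S: "finite S" "B \<subseteq> S" "\<And>v. v \<in> B \<Longrightarrow> neighbours adj v \<subseteq> S"
    and \<sigma>: "\<And>x. 0 \<le> \<sigma> x" "(\<Sum>x\<in>S. \<sigma> x) = 1"
    and \<phi>: "\<And>x. avg \<phi> x = \<phi> x + 1" "\<And>x. 0 \<le> \<phi> x"
    and p: "p < 1"
  shows "(\<exists>j\<le>k. \<exists>\<mu>. (toppling_move adj ^^ j) \<sigma> \<mu> \<and> (\<forall>x. 0 \<le> \<mu> x) \<and> p \<le> (\<Sum>x\<in>S - B. \<mu> x)) \<or>
    (\<exists>\<mu>. (toppling_move adj ^^ k) \<sigma> \<mu> \<and> (\<forall>x. 0 \<le> \<mu> x) \<and> (\<Sum>x\<in>S. \<mu> x) = 1 \<and>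
       k * ((1 - p) / card B) \<le> (\<Sum>x\<in>S. \<phi> x * \<mu> x))"
    (is "?done k \<or> ?run k")
proof (induction k)
  case 0
  have "?run 0" using \<sigma> \<phi>(2) by (auto intro!: exI[of _ \<sigma>] sum_nonneg)
  then show ?case ..
next
  case (Suc k)
  then show ?case
  proof
    assume "?done k"
    then show ?thesis using le_SucI by blast
  next
    assume "?run k"
    then obtain \<mu> where \<mu>: "(toppling_move adj ^^ k) \<sigma> \<mu>" "\<And>x. 0 \<le> \<mu> x" "(\<Sum>x\<in>S. \<mu> x) = 1"
      "k * ((1 - p) / card B) \<le> (\<Sum>x\<in>S. \<phi> x * \<mu> x)" by blast
    show ?thesis
    proof (cases "p \<le> (\<Sum>x\<in>S - B. \<mu> x)")
      case True
      then show ?thesis using \<mu>(1,2) le_SucI by blast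
    next
      case False
      have "(\<Sum>x\<in>S. \<mu> x) = (\<Sum>x\<in>S - B. \<mu> x) + (\<Sum>x\<in>B. \<mu> x)"
        using S by (simp add: sum.subset_diff)
      then have inside: "1 - p < (\<Sum>x\<in>B. \<mu> x)" using False \<mu>(3) by linarith
      then have B0: "B \<noteq> {}" using p by auto
      \<comment> \<open>Pigeonhole: some vertex carries at least the average share of the mass in
        \<open>B\<close>, and this is all that is needed of a vertex of largest mass.\<close>
      have "\<exists>v\<in>B. (1 - p) / card B \<le> \<mu> v"
      proof (rule ccontr)
        assume "\<not> ?thesis"
        then have "(\<Sum>x\<in>B. \<mu> x) \<le> (\<Sum>x\<in>B. (1 - p) / card B)" by (intro sum_mono) force
        also have "\<dots> = 1 - p" using B B0 by simp
        finally show False using inside by simp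
      qed
      then obtain v where v: "v \<in> B" "(1 - p) / card B \<le> \<mu> v" by blast
      have "0 < (1 - p) / card B" using p B B0 by (simp add: card_gt_0_iff)
      then have pos: "0 < \<mu> v" using v by linarith
      let ?\<mu>' = "topple adj v (\<mu> v) \<mu>"
      have move: "toppling_move adj \<mu> ?\<mu>'" using pos by (auto simp: toppling_move_def)
      have vS: "v \<in> S" "neighbours adj v \<subseteq> S" using v S by auto
      have "(\<Sum>x\<in>S. ?\<mu>' x) = 1"
        using sum_topple[OF S(1) vS, of "\<lambda>_. 1"] \<mu>(3) by (simp add: avg_const)
      moreover have "(\<Sum>x\<in>S. \<phi> x * ?\<mu>' x) = (\<Sum>x\<in>S. \<phi> x * \<mu> x) + \<mu> v"
        using sum_topple[OF S(1) vS, of \<phi>] by (simp add: \<phi>)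
      then have "Suc k * ((1 - p) / card B) \<le> (\<Sum>x\<in>S. \<phi> x * ?\<mu>' x)"
        using \<mu>(4) v(2) unfolding of_nat_Suc distrib_right by linarith
      moreover have "(toppling_move adj ^^ Suc k) \<sigma> ?\<mu>'"
        using \<mu>(1) move by auto
      moreover have "0 \<le> ?\<mu>' x" for x by (rule toppling_move_nonneg[OF move \<mu>(2)])
      ultimately have "?run (Suc k)" by blast
      then show ?thesis ..
    qed
  qed
qed

section \<open>The law of the simple random walk on the graph\<close>

definition walk :: "'v \<Rightarrow> nat \<Rightarrow> 'v \<Rightarrow> real" where
  "walk z t = (avg ^^ t) (indicator {z})"

lemma walk_0: "walk z 0 = indicator {z}"
  by (simp add: walk_def)

lemma walk_Suc: "walk z (Suc t) = avg (walk z t)"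
  by (simp add: walk_def)

lemma walk_nonneg: "0 \<le> walk z t x"
  by (induction t arbitrary: x) (auto simp: walk_0 walk_Suc avg_nonneg)

text \<open>The walk run for \<open>t\<close> steps is itself a toppling process whose odometer is
  the sum of its laws at times below \<open>t\<close>; this supplies the reference pair
  \<open>\<nu>\<close>, \<open>w\<close>.\<close>

lemma walk_telescope:
  "walk z t x = indicator {z} x + avg (\<lambda>x. \<Sum>s<t. walk z s x) x - (\<Sum>s<t. walk z s x)"
  by (induction t) (simp_all add: walk_0 walk_Suc avg_const avg_add avg_sum)

text \<open>By symmetry P can be moved onto the indicator of \<open>S\<close>, whose averages are at
  most 1. The hypothesis covers all finite sets because the neighbours of \<open>S\<close>
  enter.\<close>

lemma sum_avg_le:
  assumes "finite S" and nonneg: "\<And>x. 0 \<le> f x" and le: "\<And>S. finite S \<Longrightarrow> (\<Sum>x\<in>S. f x) \<le> c"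
  shows "(\<Sum>x\<in>S. avg f x) \<le> c"
proof -
  define S' where "S' = S \<union> (\<Union>x\<in>S. neighbours adj x)"
  let ?\<chi> = "\<lambda>x. if x \<in> S then 1 else 0 :: real"
  let ?f = "\<lambda>x. if x \<in> S' then f x else 0"
  have fin: "finite S'" using assms(1) finite_nbs by (auto simp: S'_def)
  have "(\<Sum>x\<in>S. avg f x) = (\<Sum>x\<in>S'. ?\<chi> x * avg ?f x)"
  proof (rule sum.mono_neutral_cong_left[OF fin])
    fix x assume "x \<in> S"
    then show "avg f x = ?\<chi> x * avg ?f x"
      by (auto simp: avg_def S'_def intro!: sum.cong)
  qed (auto simp: S'_def)
  also have "\<dots> = (\<Sum>x\<in>S'. ?f x * avg ?\<chi> x)"
    by (rule avg_symmetric[OF fin]) (auto simp: S'_def)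
  also have "\<dots> \<le> (\<Sum>x\<in>S'. f x * 1)"
  proof (rule sum_mono)
    fix x
    have "avg ?\<chi> x \<le> 1" using avg_mono[of ?\<chi> "\<lambda>_. 1" x] by (simp add: avg_const)
    moreover have "0 \<le> avg ?\<chi> x" by (rule avg_nonneg) simp
    ultimately show "?f x * avg ?\<chi> x \<le> f x * 1"
      using nonneg[of x] by (simp add: mult_left_le)
  qed
  also have "\<dots> \<le> c" using le[OF fin] by simp
  finally show ?thesis .
qed

lemma sum_walk_le: "finite S \<Longrightarrow> (\<Sum>x\<in>S. walk z t x) \<le> 1"
proof (induction t arbitrary: S)
  case 0
  have "(\<Sum>x\<in>S. indicator {z} x :: real) \<le> (\<Sum>x\<in>insert z S. indicator {z} x)"
    using 0 by (intro sum_mono2) auto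
  also have "\<dots> = 1"
    using 0 by (subst sum.remove[of _ z]) (auto intro!: sum.neutral)
  finally show ?case by (simp add: walk_0)
next
  case (Suc t)
  then show ?case by (simp add: walk_Suc sum_avg_le walk_nonneg)
qed

end


section \<open>The simple random walk on the integers\<close>

primrec srw :: "nat \<Rightarrow> int \<Rightarrow> real" where
  "srw 0 z = (if z = 0 then 1 else 0)"
| "srw (Suc m) z = (srw m (z - 1) + srw m (z + 1)) / 2"

lemma srw_nonneg: "0 \<le> srw m z"
  by (induction m arbitrary: z) auto

lemma srw_eq_0: "(\<And>j. z \<noteq> 2 * int j - int m) \<Longrightarrow> srw m z = 0"
proof (induction m arbitrary: z)
  case 0
  then show ?case using "0"[of 0] by auto
next
  case (Suc m)
  have "srw m (z - 1) = 0"
  proof (rule Suc.IH)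
    show "z - 1 \<noteq> 2 * int j - int m" for j using Suc.prems[of "Suc j"] by auto
  qed
  moreover have "srw m (z + 1) = 0"
  proof (rule Suc.IH)
    show "z + 1 \<noteq> 2 * int j - int m" for j using Suc.prems[of j] by auto
  qed
  ultimately show ?case by simp
qed

text \<open>The index \<open>j\<close> counts the steps to the right, and the recursion becomes
  Pascal's rule. For \<open>j\<close> above \<open>m\<close> both sides vanish.\<close>

lemma srw_binomial: "srw m (2 * int j - int m) = (m choose j) / 2 ^ m"
proof (induction m arbitrary: j)
  case 0
  then show ?case by (cases j) auto
next
  case (Suc m)
  have 1: "srw m (2 * int j - int (Suc m) + 1) = (m choose j) / 2 ^ m"
    using Suc.IH[of j] by (simp add: algebra_simps)
  show ?case
  proof (cases j)
    case 0
    have "srw m (2 * int j - int (Suc m) - 1) = 0"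
      by (rule srw_eq_0) (use 0 in auto)
    then show ?thesis using 0 1 by simp
  next
    case (Suc i)
    have "srw m (2 * int j - int (Suc m) - 1) = (m choose i) / 2 ^ m"
      using Suc.IH[of i] Suc by (simp add: algebra_simps)
    then show ?thesis using 1 Suc by (simp add: add_divide_distrib)
  qed
qed

lemma central_binomial_Suc: "((2 * Suc m) choose Suc m) = 2 * (Suc (2 * m) choose Suc m)"
proof -
  have "(Suc (2 * m) choose m) = (Suc (2 * m) choose Suc m)"
    using binomial_symmetric[of m "Suc (2 * m)"] by simp
  then show ?thesis by simp
qed

text \<open>Squaring makes the bound inductive: the quantity (2m+1) c^2 is multiplied by
  (2m+3)(2m+1)/(2m+2)^2, which is below 1.\<close>

lemma central_binomial_le: "((2 * m) choose m) / 4 ^ m \<le> 1 / sqrt (2 * m + 1)"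
proof -
  have "(2 * m + 1) * (((2 * m) choose m) / 4 ^ m)\<^sup>2 \<le> (1 :: real)"
  proof (induction m)
    case (Suc m)
    define c where "c = ((2 * m) choose m) / (4 ^ m :: real)"
    have "Suc m * (Suc (2 * m) choose Suc m) = Suc (2 * m) * ((2 * m) choose m)"
      by (rule Suc_times_binomial)
    then have "real (Suc m) * real (Suc (2 * m) choose Suc m) = (2 * m + 1) * real ((2 * m) choose m)"
      by (metis of_nat_mult Suc_eq_plus1)
    then have b: "real (Suc (2 * m) choose Suc m) = (2 * m + 1) / (m + 1) * real ((2 * m) choose m)"
      by (simp add: field_simps del: binomial_Suc_Suc)
    have "((2 * Suc m) choose Suc m) / (4 ^ Suc m :: real) = (2 * m + 1) / (2 * m + 2) * c"
    proof -
      have "2 * real m + 2 = 2 * (m + 1)" by simp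
      then show ?thesis
        unfolding central_binomial_Suc of_nat_mult b by (simp only: c_def power_Suc) simp
    qed
    then have step: "(2 * Suc m + 1) * (((2 * Suc m) choose Suc m) / (4 ^ Suc m :: real))\<^sup>2
      = ((2 * m + 3) * (2 * m + 1) / (2 * real m + 2)\<^sup>2) * ((2 * m + 1) * c\<^sup>2)"
      by (simp add: power_mult_distrib power_divide) (simp add: power2_eq_square algebra_simps)
    have "((2 * m + 3) * (2 * m + 1) / (2 * real m + 2)\<^sup>2) * ((2 * m + 1) * c\<^sup>2) \<le> 1 * 1"
    proof (rule mult_mono)
      show "(2 * m + 1) * c\<^sup>2 \<le> 1" using Suc by (simp add: c_def)
      have "(2 * m + 3) * (2 * m + 1) \<le> (2 * real m + 2)\<^sup>2"
        by (simp add: power2_eq_square algebra_simps)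
      then show "(2 * m + 3) * (2 * m + 1) / (2 * real m + 2)\<^sup>2 \<le> 1"
        by (simp add: divide_le_eq)
    qed auto
    then show ?case by (simp only: step mult_1_right)
  qed simp
  then have "(((2 * m) choose m) / 4 ^ m)\<^sup>2 \<le> 1 / (2 * real m + 1)"
    by (simp add: field_simps)
  then have "sqrt ((((2 * m) choose m) / 4 ^ m)\<^sup>2) \<le> sqrt (1 / (2 * real m + 1))"
    by (rule real_sqrt_le_mono)
  then show ?thesis by (simp add: real_sqrt_divide)
qed

lemma binomial_div_power_le: "(m choose j) / 2 ^ m \<le> 1 / sqrt (m + 1)"
proof -
  have mid: "(m choose (m div 2)) / 2 ^ m \<le> 1 / sqrt (m + 1)"
  proof (cases "even m")
    case True
    then obtain k where "m = 2 * k" by blast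
    then show ?thesis using central_binomial_le[of k] by (simp add: power_mult add.commute)
  next
    case False
    then obtain k where k: "m = Suc (2 * k)" by (metis oddE Suc_eq_plus1)
    have "(Suc (2 * k) choose k) = (Suc (2 * k) choose Suc k)"
      using binomial_symmetric[of k "Suc (2 * k)"] by simp
    \<comment> \<open>For odd \<open>m\<close> the middle probability equals the central one for the
      next even number.\<close>
    then have "(m choose (m div 2)) / 2 ^ m = ((2 * Suc k) choose Suc k) / (4 ^ Suc k :: real)"
      unfolding k central_binomial_Suc by (simp add: power_mult del: binomial_Suc_Suc)
    also have "\<dots> \<le> 1 / sqrt (2 * Suc k + 1)"
      using central_binomial_le[of "Suc k"] by (simp only: of_nat_mult of_nat_add of_nat_1 of_nat_numeral)
    also have "\<dots> \<le> 1 / sqrt (m + 1)" by (rule divide_left_mono) (auto simp: k)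
    finally show ?thesis .
  qed
  have "(m choose j) / 2 ^ m \<le> (m choose (m div 2)) / (2 ^ m :: real)"
    by (intro divide_right_mono) (auto intro: binomial_maximum)
  from order_trans[OF this mid] show ?thesis by (simp add: add.commute)
qed

lemma srw_le: "srw m z \<le> 1 / sqrt (m + 1)"
proof (cases "\<exists>j. z = 2 * int j - int m")
  case True
  then obtain j where "z = 2 * int j - int m" by blast
  then show ?thesis using binomial_div_power_le[of m j] by (simp only: srw_binomial of_nat_add of_nat_1)
qed (auto simp: srw_eq_0)

section \<open>The lattice\<close>

definition l1 :: "int ^ 'd \<Rightarrow> int" where
  "l1 x = (\<Sum>i\<in>UNIV. \<bar>x $ i\<bar>)"

lemma l1_nonneg: "0 \<le> l1 x"
  by (simp add: l1_def sum_nonneg)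

lemma l1_0: "l1 0 = 0"
  by (simp add: l1_def)

lemma l1_eq_0_iff: "l1 x = 0 \<longleftrightarrow> x = 0"
  by (auto simp: l1_def sum_nonneg_eq_0_iff vec_eq_iff)

lemma l1_triangle: "l1 (x + y) \<le> l1 x + l1 y"
  by (auto simp: l1_def simp flip: sum.distrib intro!: sum_mono)

lemma l1_minus_commute: "l1 (x - y) = l1 (y - x)"
  by (simp add: l1_def abs_minus_commute)

lemma lattice_adj_iff_l1: "lattice_adj x y \<longleftrightarrow> l1 (x - y) = 1"
  by (simp add: lattice_adj_def l1_def)

lemma component_le_l1: "\<bar>x $ i\<bar> \<le> l1 x"
  unfolding l1_def by (rule member_le_sum) auto

lemma axis_neg: "axis i (- s) = - axis i (s :: int)"
  by (simp add: axis_def vec_eq_iff)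

lemma l1_axis: "l1 (axis i s) = \<bar>s\<bar>"
  by (simp add: l1_def axis_def if_distrib[of abs] cong: if_cong)

lemma l1_eq_1E:
  assumes "l1 x = 1"
  obtains i where "x = axis i 1 \<or> x = axis i (-1)"
proof -
  have "x \<noteq> 0" using assms by (auto simp: l1_0)
  then obtain i where i: "x $ i \<noteq> 0" by (auto simp: vec_eq_iff)
  have split: "l1 x = \<bar>x $ i\<bar> + (\<Sum>j\<in>UNIV - {i}. \<bar>x $ j\<bar>)"
    unfolding l1_def by (rule sum.remove) auto
  moreover have "0 \<le> (\<Sum>j\<in>UNIV - {i}. \<bar>x $ j\<bar>)" by (rule sum_nonneg) auto
  ultimately have "(\<Sum>j\<in>UNIV - {i}. \<bar>x $ j\<bar>) = 0" "\<bar>x $ i\<bar> = 1"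
    using i assms by linarith+
  then have "x $ j = 0" if "j \<noteq> i" for j
    using that by (simp add: sum_nonneg_eq_0_iff)
  moreover have "x $ i = 1 \<or> x $ i = - 1" using \<open>\<bar>x $ i\<bar> = 1\<close> by linarith
  ultimately have "x = axis i 1 \<or> x = axis i (-1)" by (auto simp: axis_def vec_eq_iff)
  then show ?thesis by (rule that)
qed

lemma neighbours_lattice:
  "neighbours lattice_adj x = (\<lambda>(i, s). x + axis i s) ` (UNIV \<times> {1, -1})"
proof (intro set_eqI iffI)
  fix y assume "y \<in> neighbours lattice_adj x"
  then have "l1 (y - x) = 1"
    by (simp add: neighbours_def lattice_adj_iff_l1 l1_minus_commute[of y])
  then obtain i s where "y - x = axis i s" "s \<in> {1, -1}"
    by (elim l1_eq_1E) blast
  then show "y \<in> (\<lambda>(i, s). x + axis i s) ` (UNIV \<times> {1, -1})"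
    by (intro image_eqI[of _ _ "(i, s)"]) (auto simp: algebra_simps)
next
  fix y assume "y \<in> (\<lambda>(i, s). x + axis i s) ` (UNIV \<times> {1, -1})"
  then show "y \<in> neighbours lattice_adj x"
  proof
    fix a assume a: "y = (\<lambda>(i, s). x + axis i s) a" "a \<in> UNIV \<times> {1, -1}"
    obtain i s where "a = (i, s)" by (cases a)
    with a have "x - y = - axis i s" "\<bar>s\<bar> = 1" by auto
    then have "l1 (x - y) = 1" by (simp add: l1_axis flip: axis_neg)
    then show ?thesis by (simp add: neighbours_def lattice_adj_iff_l1)
  qed
qed

lemma inj_on_axis_translate:
  "inj_on (\<lambda>(i, s). x + axis i s) (UNIV \<times> {1, -1 :: int})"
  by (auto simp: inj_on_def axis_eq_axis)

interpretation lattice: regular_graph "lattice_adj :: int ^ 'd \<Rightarrow> _" "2 * CARD('d)"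
proof
  fix x y :: "int ^ 'd"
  show "lattice_adj x y \<longleftrightarrow> lattice_adj y x" by (rule lattice_adj_sym)
  show "finite (neighbours lattice_adj x)" by (rule finite_neighbours_lattice)
  show "card (neighbours lattice_adj x) = 2 * CARD('d)"
    unfolding neighbours_lattice card_image[OF inj_on_axis_translate]
    by (simp add: card_cartesian_product)
qed simp

lemma lattice_avg:
  fixes x :: "int ^ 'd"
  shows "lattice.avg f x = (\<Sum>i\<in>UNIV. f (x + axis i 1) + f (x - axis i 1)) / (2 * CARD('d))"
proof -
  have "(\<Sum>y\<in>neighbours lattice_adj x. f y) = (\<Sum>(i, s)\<in>UNIV \<times> {1, -1}. f (x + axis i s))"
    unfolding neighbours_lattice sum.reindex[OF inj_on_axis_translate]
    by (intro sum.cong) auto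
  also have "\<dots> = (\<Sum>i\<in>UNIV. f (x + axis i 1) + f (x - axis i 1))"
    by (simp add: axis_neg flip: sum.cartesian_product)
  finally show ?thesis by (simp add: lattice.avg_def)
qed

section \<open>Graph distance and balls in the l1 norm\<close>

lemma relpowp_lattice_adj_l1:
  "(lattice_adj ^^ k) x y \<Longrightarrow> l1 (x - y) \<le> int k"
proof (induction k arbitrary: y)
  case (Suc k)
  obtain z where z: "(lattice_adj ^^ k) x z" "lattice_adj z y"
    using Suc.prems by (rule relpowp_Suc_cases)
  then show ?case
    using l1_triangle[of "x - z" "z - y"] Suc.IH[OF z(1)] by (simp add: lattice_adj_iff_l1)
qed (simp add: l1_0)

lemma lattice_path:
  "l1 x = int k \<Longrightarrow> (lattice_adj ^^ k) x 0"
proof (induction k arbitrary: x)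
  case 0
  then show ?case by (simp add: l1_eq_0_iff)
next
  case (Suc k)
  then have "x \<noteq> 0" by (auto simp: l1_0)
  then obtain i where i: "x $ i \<noteq> 0" by (auto simp: vec_eq_iff)
  \<comment> \<open>A unit step towards 0 along a nonzero coordinate lowers the l1 norm by
    one.\<close>
  define y where "y = x - axis i (sgn (x $ i))"
  have "l1 x = \<bar>x $ i\<bar> + (\<Sum>j\<in>UNIV - {i}. \<bar>x $ j\<bar>)"
    unfolding l1_def by (rule sum.remove) auto
  moreover have "l1 y = \<bar>y $ i\<bar> + (\<Sum>j\<in>UNIV - {i}. \<bar>y $ j\<bar>)"
    unfolding l1_def by (rule sum.remove) auto
  moreover have "(\<Sum>j\<in>UNIV - {i}. \<bar>y $ j\<bar>) = (\<Sum>j\<in>UNIV - {i}. \<bar>x $ j\<bar>)"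
    by (rule sum.cong) (auto simp: y_def axis_def)
  moreover have "\<bar>y $ i\<bar> = \<bar>x $ i\<bar> - 1"
    using i by (auto simp: y_def axis_def sgn_if)
  ultimately have "l1 y = int k" using Suc.prems by simp
  moreover have "lattice_adj x y"
    using i by (simp add: lattice_adj_iff_l1 y_def l1_axis sgn_if)
  ultimately show ?case using Suc.IH relpowp_Suc_I2 by metis
qed

lemma graph_ball_lattice: "graph_ball lattice_adj (0 :: int ^ 'd) n = {v. l1 v < int n}"
proof (intro set_eqI)
  fix v :: "int ^ 'd"
  have "v \<in> graph_ball lattice_adj 0 n \<longleftrightarrow> (\<exists>k<n. (lattice_adj ^^ k) v 0)"
    by (auto simp: graph_ball_def graph_dist_def INF_less_iff)
  also have "\<dots> \<longleftrightarrow> l1 v < int n"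
  proof
    assume "\<exists>k<n. (lattice_adj ^^ k) v 0"
    then show "l1 v < int n" using relpowp_lattice_adj_l1[of _ v 0] by force
  next
    assume "l1 v < int n"
    then show "\<exists>k<n. (lattice_adj ^^ k) v 0"
      using lattice_path[of v "nat (l1 v)"] l1_nonneg[of v] by (intro exI[of _ "nat (l1 v)"]) auto
  qed
  finally show "v \<in> graph_ball lattice_adj 0 n \<longleftrightarrow> v \<in> {v. l1 v < int n}" by simp
qed

lemma l1_ball_finite_card:
  shows "finite {v :: int ^ 'd. l1 v \<le> int n}"
    and "card {v :: int ^ 'd. l1 v \<le> int n} \<le> (2 * n + 1) ^ CARD('d)"
proof -
  let ?B = "{v :: int ^ 'd. l1 v \<le> int n}" and ?X = "\<Pi>\<^sub>E i\<in>(UNIV :: 'd set). {- int n..int n}"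
  have "v $ i \<in> {- int n..int n}" if "v \<in> ?B" for v :: "int ^ 'd" and i
    using component_le_l1[of v i] that by auto
  then have sub: "vec_nth ` ?B \<subseteq> ?X"
    by (intro image_subsetI PiE_I) simp_all
  have inj: "inj_on vec_nth ?B" by (simp add: inj_on_def vec_nth_inject)
  have X: "finite ?X" by (intro finite_PiE) auto
  show "finite ?B" using finite_subset[OF sub X] inj by (rule finite_imageD)
  have "card ?B \<le> card ?X" by (rule card_inj_on_le[OF inj sub X])
  also have "\<dots> = (2 * n + 1) ^ CARD('d)"
    by (simp add: card_PiE nat_add_distrib nat_mult_distrib)
  finally show "card ?B \<le> (2 * n + 1) ^ CARD('d)" .
qed

section \<open>The squared Euclidean norm as moment function\<close>

definition sqnorm :: "int ^ 'd \<Rightarrow> real" where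
  "sqnorm x = (\<Sum>i\<in>UNIV. (real_of_int (x $ i))\<^sup>2)"

lemma sqnorm_nonneg: "0 \<le> sqnorm x"
  by (simp add: sqnorm_def sum_nonneg)

lemma sqnorm_add_axis: "sqnorm (x + axis i s) = sqnorm x + 2 * x $ i * s + s\<^sup>2"
proof -
  have "sqnorm (x + axis i s) = (\<Sum>j\<in>UNIV. (real_of_int (x $ j))\<^sup>2 + (if j = i then 2 * x $ i * s + s\<^sup>2 else 0))"
    unfolding sqnorm_def
    by (rule sum.cong) (auto simp: axis_def power2_eq_square algebra_simps)
  also have "\<dots> = sqnorm x + (\<Sum>j\<in>UNIV. if j = i then 2 * real_of_int (x $ i) * s + s\<^sup>2 else 0)"
    unfolding sqnorm_def sum.distrib by (rule arg_cong2[where f = "(+)"], rule refl, rule sum.cong) auto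
  finally show ?thesis by simp
qed

text \<open>The linear terms of opposite neighbours cancel and each unit step adds 1, so
  \<open>sqnorm\<close> can serve as \<open>\<phi>\<close> above.\<close>

lemma avg_sqnorm: "lattice.avg sqnorm x = sqnorm x + 1"
proof -
  have "sqnorm (x + axis i 1) + sqnorm (x - axis i 1) = 2 * sqnorm x + 2" for i
    using sqnorm_add_axis[of x i 1] sqnorm_add_axis[of x i "-1"] by (simp add: axis_neg)
  then show ?thesis unfolding lattice_avg by (simp add: field_simps)
qed

lemma sqnorm_le_l1: "sqnorm x \<le> (real_of_int (l1 x))\<^sup>2"
proof -
  have "sqnorm x = (\<Sum>i\<in>UNIV. \<bar>real_of_int (x $ i)\<bar> * \<bar>real_of_int (x $ i)\<bar>)"
    by (simp add: sqnorm_def power2_eq_square)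
  also have "\<dots> \<le> (\<Sum>i\<in>UNIV. \<bar>real_of_int (x $ i)\<bar> * real_of_int (l1 x))"
    by (intro sum_mono mult_left_mono) (use component_le_l1[of x] in \<open>auto simp flip: of_int_abs\<close>)
  also have "\<dots> = (real_of_int (l1 x))\<^sup>2"
    by (simp add: l1_def power2_eq_square sum_distrib_right)
  finally show ?thesis .
qed

lemma l1_le_sqnorm: "(real_of_int (l1 (x :: int ^ 'd)))\<^sup>2 \<le> CARD('d) * sqnorm x"
  using sum_squared_le_sum_of_squares[of "\<lambda>i. \<bar>real_of_int (x $ i)\<bar>" "UNIV :: 'd set"]
  by (simp add: l1_def sqnorm_def mult.commute)


section \<open>Decay of the heat kernel on the lattice\<close>

text \<open>The joint law of independent walks on the integers, one per coordinate, with
  \<open>k i\<close> steps in coordinate \<open>i\<close>.\<close>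

definition prod_srw :: "('d::finite \<Rightarrow> nat) \<Rightarrow> int ^ 'd \<Rightarrow> real" where
  "prod_srw k x = (\<Prod>i\<in>UNIV. srw (k i) (x $ i))"

lemma prod_srw_step:
  "prod_srw (k(i := Suc (k i))) x = (prod_srw k (x + axis i 1) + prod_srw k (x - axis i 1)) / 2"
proof -
  define Q where "Q = (\<Prod>j\<in>UNIV - {i}. srw (k j) (x $ j))"
  have split: "prod_srw k' y = srw (k' i) (y $ i) * Q"
    if "\<And>j. j \<noteq> i \<Longrightarrow> k' j = k j \<and> y $ j = x $ j" for k' y
  proof -
    have "prod_srw k' y = srw (k' i) (y $ i) * (\<Prod>j\<in>UNIV - {i}. srw (k' j) (y $ j))"
      unfolding prod_srw_def by (rule prod.remove) auto
    also have "(\<Prod>j\<in>UNIV - {i}. srw (k' j) (y $ j)) = Q"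
      unfolding Q_def by (rule prod.cong) (use that in auto)
    finally show ?thesis .
  qed
  have "prod_srw (k(i := Suc (k i))) x = srw (Suc (k i)) (x $ i) * Q"
    by (subst split) auto
  moreover have "prod_srw k (x + axis i 1) = srw (k i) (x $ i + 1) * Q"
    by (subst split) (auto simp: axis_def)
  moreover have "prod_srw k (x - axis i 1) = srw (k i) (x $ i - 1) * Q"
    by (subst split) (auto simp: axis_def)
  ultimately show ?thesis by (simp add: algebra_simps add_divide_distrib)
qed

text \<open>\<open>srw_mixture t k\<close> is the law at time \<open>t\<close> of the lattice walk started from \<open>prod_srw k\<close>,
  written as a mixture over the number of steps made in each coordinate.\<close>

primrec srw_mixture :: "nat \<Rightarrow> ('d::finite \<Rightarrow> nat) \<Rightarrow> int ^ 'd \<Rightarrow> real" where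
  "srw_mixture 0 k = prod_srw k"
| "srw_mixture (Suc t) k =
    (\<lambda>x. (\<Sum>i\<in>UNIV. srw_mixture t (k(i := Suc (k i))) x) / CARD('d))"

text \<open>The recursion adds a step to the initial law, whereas \<open>avg\<close> acts on the
  final one; linearity of \<open>avg\<close> lets the two be interchanged.\<close>

lemma srw_mixture_Suc: "srw_mixture (Suc t) k = lattice.avg (srw_mixture t k)"
proof (induction t arbitrary: k)
  case 0
  show ?case by (rule ext) (simp add: lattice_avg prod_srw_step flip: sum_divide_distrib)
next
  case (Suc t)
  show ?case
  proof
    fix x
    have "srw_mixture (Suc (Suc t)) k x
        = (\<Sum>i\<in>UNIV. lattice.avg (srw_mixture t (k(i := Suc (k i)))) x) / CARD('a)"
      by (subst srw_mixture.simps) (simp only: Suc.IH)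
    also have "\<dots> = lattice.avg (\<lambda>x. (\<Sum>i\<in>UNIV. srw_mixture t (k(i := Suc (k i))) x) / CARD('a)) x"
      by (simp only: divide_inverse mult.commute[of _ "inverse _"] lattice.avg_cmult lattice.avg_sum)
    finally show "srw_mixture (Suc (Suc t)) k x = lattice.avg (srw_mixture (Suc t) k) x"
      by simp
  qed
qed

lemma walk_eq_srw_mixture: "lattice.walk 0 t = srw_mixture t (\<lambda>_. 0)"
proof (induction t)
  case 0
  have "indicator {0} x = (\<Prod>i\<in>UNIV. srw 0 (x $ i))" for x :: "int ^ 'a"
  proof (cases "x = 0")
    case False
    then show ?thesis by (auto simp: vec_eq_iff intro!: prod_zero)
  qed simp
  then show ?case by (auto simp: lattice.walk_0 prod_srw_def)
next
  case (Suc t)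
  then show ?case by (simp only: lattice.walk_Suc srw_mixture_Suc)
qed

text \<open>The functions \<open>k \<mapsto> (1 / 2) ^ k i\<close> are eigenfunctions of the mixing step; they control the
  event that some coordinate has made few steps.\<close>

lemma srw_mixture_le:
  fixes x :: "int ^ 'd"
  assumes "\<And>k. prod_srw k x \<le> A + C * (\<Sum>i\<in>UNIV. (1 / 2) ^ k i)"
  shows "srw_mixture t k x \<le> A + C * (1 - 1 / (2 * real CARD('d))) ^ t * (\<Sum>i\<in>UNIV. (1 / 2) ^ k i)"
proof (induction t arbitrary: k)
  case 0
  then show ?case using assms by simp
next
  case (Suc t)
  let ?d = "real CARD('d)" and ?s = "\<lambda>k :: 'd \<Rightarrow> nat. \<Sum>i\<in>UNIV. (1 / 2 :: real) ^ k i"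
  let ?r = "1 - 1 / (2 * ?d)"
  have s: "?s (k(i := Suc (k i))) = ?s k - (1 / 2) ^ k i / 2" for i
  proof -
    have "?s (k(i := Suc (k i))) = (\<Sum>j\<in>UNIV. (1 / 2) ^ k j - (if j = i then (1 / 2) ^ k i / 2 else 0))"
      by (rule sum.cong) auto
    then show ?thesis by (simp add: sum_subtractf)
  qed
  \<comment> \<open>Raising \<open>k i\<close> halves one summand of \<open>?s k\<close>, so all
    \<open>i\<close> together lose half of \<open>?s k\<close>; this is the eigenvalue
    \<open>?r\<close> after division by \<open>?d\<close>.\<close>
  have "(\<Sum>i\<in>UNIV. ?s (k(i := Suc (k i)))) = ?d * ?s k - ?s k / 2"
    unfolding s by (simp add: sum_subtractf sum_divide_distrib)
  then have mean: "(\<Sum>i\<in>UNIV. ?s (k(i := Suc (k i)))) / ?d = ?r * ?s k"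
    by (simp add: field_simps)
  have "srw_mixture (Suc t) k x \<le> (\<Sum>i\<in>UNIV. A + C * ?r ^ t * ?s (k(i := Suc (k i)))) / ?d"
    unfolding srw_mixture.simps by (intro divide_right_mono sum_mono Suc.IH) auto
  also have "\<dots> = A + C * ?r ^ t * ((\<Sum>i\<in>UNIV. ?s (k(i := Suc (k i)))) / ?d)"
    by (simp only: sum.distrib sum_distrib_left[symmetric]) (simp add: add_divide_distrib)
  also have "\<dots> = A + C * ?r ^ Suc t * ?s k"
    unfolding mean by simp
  finally show ?case .
qed

text \<open>If every coordinate has made \<open>R\<close> steps, each factor obeys the
  one-dimensional bound. Otherwise a coordinate with fewer steps makes the second term at least 1,
  which bounds any probability.\<close>

lemma prod_srw_le:
  fixes x :: "int ^ 'd"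
  shows "prod_srw k x \<le> (1 / sqrt (real R + 1)) ^ CARD('d) + 2 ^ R * (\<Sum>i\<in>UNIV. (1 / 2) ^ k i)"
proof (cases "\<forall>i. R \<le> k i")
  case True
  have "prod_srw k x \<le> (\<Prod>i\<in>(UNIV :: 'd set). 1 / sqrt (real R + 1))"
    unfolding prod_srw_def
  proof (rule prod_mono, intro conjI srw_nonneg)
    fix i
    have "srw (k i) (x $ i) \<le> 1 / sqrt (k i + 1)" by (rule srw_le)
    also have "\<dots> \<le> 1 / sqrt (real R + 1)"
      using True by (intro divide_left_mono) auto
    finally show "srw (k i) (x $ i) \<le> 1 / sqrt (real R + 1)" .
  qed
  moreover have "0 \<le> 2 ^ R * (\<Sum>i\<in>UNIV. (1 / 2 :: real) ^ k i)"
    by (intro mult_nonneg_nonneg sum_nonneg) auto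
  ultimately show ?thesis by simp
next
  case False
  then obtain i where "k i < R" by (auto simp: not_le)
  have "srw m z \<le> 1" for m z
    using srw_le[of m z] by (rule order_trans) (simp add: divide_le_eq)
  then have "prod_srw k x \<le> 1"
    unfolding prod_srw_def by (intro prod_le_1) (auto simp: srw_nonneg)
  also have "1 \<le> 2 ^ R * (1 / 2 :: real) ^ k i"
    using power_increasing[of "k i" R "2 :: real"] \<open>k i < R\<close> by (simp add: power_divide field_simps)
  also have "\<dots> \<le> 2 ^ R * (\<Sum>i\<in>UNIV. (1 / 2) ^ k i)"
    by (intro mult_left_mono member_le_sum) auto
  also have "\<dots> \<le> (1 / sqrt (real R + 1)) ^ CARD('d) + \<dots>" by simp
  finally show ?thesis .
qed

lemma walk_le:
  fixes x :: "int ^ 'd"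
  shows "lattice.walk 0 t x
    \<le> (1 / sqrt (real R + 1)) ^ CARD('d) + 2 ^ R * (1 - 1 / (2 * real CARD('d))) ^ t * CARD('d)"
proof -
  have "srw_mixture t (\<lambda>_. 0) x \<le> (1 / sqrt (real R + 1)) ^ CARD('d)
      + 2 ^ R * (1 - 1 / (2 * real CARD('d))) ^ t * (\<Sum>i\<in>(UNIV :: 'd set). (1 / 2) ^ 0)"
    by (rule srw_mixture_le, rule prod_srw_le)
  then show ?thesis by (simp add: walk_eq_srw_mixture)
qed

text \<open>One term of the exponential series; it turns exponential decay into a power of
  \<open>n\<close>.\<close>

lemma power_le_fact_mult_exp:
  fixes y :: real
  assumes "0 \<le> y"
  shows "y ^ m \<le> fact m * exp y"
proof -
  have "(\<Sum>i\<in>{m}. inverse (fact i) * y ^ i) \<le> (\<Sum>i. inverse (fact i) * y ^ i)"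
    using assms by (intro sum_le_suminf summable_exp) auto
  then show ?thesis
    by (simp add: exp_def scaleR_conv_of_real field_simps)
qed

lemma heat_kernel_bound:
  fixes a :: real
  assumes "0 < a"
  obtains C where "0 < C" "\<And>n t (x :: int ^ 'd). 1 \<le> n \<Longrightarrow> a * (real n)\<^sup>2 \<le> real t + 1 \<Longrightarrow>
    lattice.walk 0 t x \<le> C / real n ^ CARD('d)"
proof -
  let ?d = "CARD('d)"
  define b where "b = a / (4 * ?d)"
  have b: "0 < b" using assms by (simp add: b_def)
  \<comment> \<open>The first summand pays for the product bound, the second for the event that some
    coordinate makes few steps.\<close>
  define C where "C = 1 / sqrt b ^ ?d + exp 1 * ?d * fact ?d / b ^ ?d"
  have "0 < C" using b by (auto simp: C_def intro!: add_pos_nonneg)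
  moreover have "lattice.walk 0 t x \<le> C / real n ^ ?d"
    if n: "1 \<le> n" and t: "a * (real n)\<^sup>2 \<le> real t + 1" for n t and x :: "int ^ 'd"
  proof -
    \<comment> \<open>A coordinate makes about t/d steps on average. With a quarter of this,
      \<open>2 ^ R\<close> is at most exp(t/(4d)) and loses against the decay exp(-t/(2d)).\<close>
    define R where "R = t div (4 * ?d)"
    define y where "y = b * (real n)\<^sup>2"
    have y: "y = a * (real n)\<^sup>2 / (4 * ?d)" by (simp add: y_def b_def)
    have y0: "0 < y" using b n by (simp add: y_def)
    have "t + 1 \<le> (R + 1) * (4 * ?d)"
      using mod_less_divisor[of "4 * ?d" t] div_mult_mod_eq[of t "4 * ?d"]
      by (simp add: R_def algebra_simps del: mod_less_divisor div_mult_mod_eq)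
    then have "real (t + 1) \<le> real ((R + 1) * (4 * ?d))" by (rule of_nat_mono)
    then have "real t + 1 \<le> (real R + 1) * (4 * ?d)" by (simp add: algebra_simps)
    then have yR: "y \<le> real R + 1"
      using t unfolding y by (simp add: divide_le_eq)
    have "(1 / sqrt (real R + 1)) ^ ?d \<le> (1 / (sqrt b * n)) ^ ?d"
    proof (rule power_mono)
      have "sqrt b * n = sqrt y" using n by (simp add: y_def real_sqrt_mult)
      then show "1 / sqrt (real R + 1) \<le> 1 / (sqrt b * n)"
        using yR y0 by (auto intro!: divide_left_mono)
    qed simp
    also have "\<dots> = (1 / sqrt b ^ ?d) / real n ^ ?d"
      by (simp add: power_divide power_mult_distrib)
    finally have 1: "(1 / sqrt (real R + 1)) ^ ?d \<le> (1 / sqrt b ^ ?d) / real n ^ ?d" .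
    have "1 \<le> ?d" by (simp add: Suc_leI)
    then have d1: "1 \<le> 2 * real ?d" "1 \<le> 4 * real ?d" by linarith+
    have r0: "0 \<le> 1 - 1 / real (2 * ?d)"
      using d1 by (simp add: divide_le_eq_1 del: of_nat_le_iff)
    define z where "z = real t / (4 * ?d)"
    have "2 ^ R \<le> exp z"
    proof -
      have "(2 :: real) ^ R \<le> exp 1 ^ R" using exp_ge_add_one_self[of 1] by (intro power_mono) auto
      also have "\<dots> = exp (real R)" by (simp flip: exp_of_nat_mult)
      also have "real R \<le> z" unfolding R_def z_def using of_nat_div_le_of_nat[of t "4 * ?d"] by simp
      finally show ?thesis by simp
    qed
    moreover have "(1 - 1 / (2 * ?d)) ^ t \<le> exp (- 2 * z)"
    proof -
      have "(1 - 1 / (2 * ?d)) ^ t \<le> exp (- 1 / (2 * ?d)) ^ t"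
      proof (rule power_mono)
        show "1 - 1 / (2 * ?d) \<le> exp (- 1 / (2 * ?d))"
          using exp_ge_add_one_self[of "- 1 / (2 * ?d)"] by simp
      qed (rule r0)
      also have "\<dots> = exp (- 2 * z)" by (simp add: z_def flip: exp_of_nat_mult)
      finally show ?thesis .
    qed
    ultimately have "2 ^ R * (1 - 1 / (2 * ?d)) ^ t \<le> exp z * exp (- 2 * z)"
      by (intro mult_mono zero_le_power r0) auto
    also have "\<dots> = exp (- z)" by (simp flip: exp_add)
    \<comment> \<open>The hypothesis bounds only \<open>t + 1\<close> from below; the lost unit
      costs the factor \<open>exp 1\<close> in \<open>C\<close>.\<close>
    also have "\<dots> \<le> exp (1 - y)"
    proof -
      have "y \<le> (real t + 1) / (4 * ?d)" unfolding y using t by (intro divide_right_mono) auto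
      also have "\<dots> \<le> z + 1" using d1 by (simp add: z_def add_divide_distrib divide_le_eq_1)
      finally show ?thesis by simp
    qed
    also have "\<dots> = exp 1 / exp y" by (rule exp_diff)
    also have "\<dots> \<le> exp 1 * (fact ?d / b ^ ?d / real n ^ ?d)"
    proof -
      have "b ^ ?d * real n ^ ?d = (b * real n) ^ ?d" by (simp add: power_mult_distrib)
      also have "\<dots> \<le> y ^ ?d"
      proof (rule power_mono)
        show "b * real n \<le> y" using b n by (simp add: y_def power2_eq_square)
      qed (use b in auto)
      also have "\<dots> \<le> fact ?d * exp y" using y0 by (intro power_le_fact_mult_exp) auto
      finally have "1 / exp y \<le> fact ?d / (b ^ ?d * real n ^ ?d)"
        using b n by (simp add: field_simps)
      then have "exp 1 * (1 / exp y) \<le> exp 1 * (fact ?d / (b ^ ?d * real n ^ ?d))"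
        by (rule mult_left_mono) auto
      then show ?thesis by simp
    qed
    finally have "2 ^ R * (1 - 1 / (2 * ?d)) ^ t * ?d \<le> exp 1 * (fact ?d / b ^ ?d / real n ^ ?d) * ?d"
      by (rule mult_right_mono) auto
    then show ?thesis
      using 1 walk_le[of t x R] by (simp add: C_def add_divide_distrib mult_ac)
  qed
  ultimately show ?thesis by (rule that)
qed

section \<open>The two bounds\<close>

lemma lattice_upper:
  fixes p :: real
  assumes p: "p < 1" and n: "1 \<le> n"
  shows "\<exists>j \<mu>. (toppling_move lattice_adj ^^ j) (indicator {0}) \<mu> \<and>
    ennreal p \<le> (\<Sum>\<^sub>\<infinity>v\<in>- graph_ball lattice_adj (0 :: int ^ 'd) n. ennreal (\<mu> v)) \<and>
    real j \<le> (3 ^ CARD('d) / (1 - p) + 1) * real n ^ (CARD('d) + 2)"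
proof -
  let ?d = "CARD('d)"
  define B where "B = graph_ball lattice_adj (0 :: int ^ 'd) n"
  define S where "S = {v :: int ^ 'd. l1 v \<le> int n}"
  \<comment> \<open>One move more than the second moment allows:
    \<open>K * ((1 - p) / card B)\<close> exceeds n^2, the largest value of \<open>sqnorm\<close> on
    \<open>S\<close>.\<close>
  define K where "K = nat \<lfloor>(real n)\<^sup>2 * card B / (1 - p)\<rfloor> + 1"
  have finS: "finite S" unfolding S_def by (rule l1_ball_finite_card)
  have BS: "B \<subseteq> S" by (auto simp: B_def S_def graph_ball_lattice)
  have finB: "finite B" using finite_subset[OF BS finS] .
  have "0 \<in> B" using n by (simp add: B_def graph_ball_lattice l1_0)
  then have cB: "0 < card B" using finB by (auto simp: card_gt_0_iff)
  have nb: "neighbours lattice_adj v \<subseteq> S" if "v \<in> B" for v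
  proof
    fix y assume "y \<in> neighbours lattice_adj v"
    then have "l1 (y - v) = 1"
      by (simp add: neighbours_def lattice_adj_iff_l1 l1_minus_commute[of y])
    then show "y \<in> S"
      using that l1_triangle[of v "y - v"] by (simp add: B_def S_def graph_ball_lattice)
  qed
  have ind: "(\<Sum>x\<in>S. indicator {0} x :: real) = 1"
    using finS \<open>0 \<in> B\<close> BS by (subst sum.remove[of _ 0]) (auto intro!: sum.neutral)
  have K: "real K \<le> (3 ^ ?d / (1 - p) + 1) * real n ^ (?d + 2)"
  proof -
    have "card B \<le> (2 * n + 1) ^ ?d"
      using card_mono[OF finS BS] l1_ball_finite_card(2)[where 'd = 'd, of n] by (simp add: S_def)
    also have "\<dots> \<le> (3 * n) ^ ?d" using n by (intro power_mono) auto
    finally have "real (card B) \<le> real ((3 * n) ^ ?d)" by (rule of_nat_mono)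
    then have "(real n)\<^sup>2 * card B / (1 - p) \<le> (real n)\<^sup>2 * (3 * n) ^ ?d / (1 - p)"
      using p by (intro divide_right_mono mult_left_mono) auto
    also have "\<dots> = 3 ^ ?d / (1 - p) * real n ^ (?d + 2)"
      by (simp add: power_mult_distrib power_add power2_eq_square)
    finally have "(real n)\<^sup>2 * card B / (1 - p) \<le> 3 ^ ?d / (1 - p) * real n ^ (?d + 2)" .
    moreover have "real K \<le> (real n)\<^sup>2 * card B / (1 - p) + 1"
      using p by (simp add: K_def)
    moreover have "1 \<le> real n ^ (?d + 2)" using n by (intro one_le_power) auto
    ultimately show ?thesis by (simp add: distrib_right)
  qed
  \<comment> \<open>This rules out the second alternative of \<open>greedy_toppling\<close> at time
    \<open>K\<close>.\<close>
  have "\<not> (\<exists>\<mu>. (toppling_move lattice_adj ^^ K) (indicator {0}) \<mu> \<and> (\<forall>x. 0 \<le> \<mu> x) \<and>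
      (\<Sum>x\<in>S. \<mu> x) = 1 \<and> K * ((1 - p) / card B) \<le> (\<Sum>x\<in>S. sqnorm x * \<mu> x))"
  proof safe
    fix \<mu> :: "int ^ 'd \<Rightarrow> real"
    assume \<mu>: "\<forall>x. 0 \<le> \<mu> x" "(\<Sum>x\<in>S. \<mu> x) = 1" "K * ((1 - p) / card B) \<le> (\<Sum>x\<in>S. sqnorm x * \<mu> x)"
    have "(\<Sum>x\<in>S. sqnorm x * \<mu> x) \<le> (\<Sum>x\<in>S. (real n)\<^sup>2 * \<mu> x)"
    proof (intro sum_mono mult_right_mono)
      fix x assume "x \<in> S"
      then have "real_of_int (l1 x) \<le> real n" by (simp add: S_def)
      then have "(real_of_int (l1 x))\<^sup>2 \<le> (real n)\<^sup>2"
        using l1_nonneg[of x] by (intro power_mono) auto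
      then show "sqnorm x \<le> (real n)\<^sup>2" using sqnorm_le_l1[of x] by linarith
    qed (use \<mu> in auto)
    also have "\<dots> = (real n)\<^sup>2" using \<mu>(2) by (simp flip: sum_distrib_left)
    finally have "K * ((1 - p) / card B) \<le> (real n)\<^sup>2" using \<mu>(3) by linarith
    then have "real K \<le> (real n)\<^sup>2 * card B / (1 - p)"
      using p cB by (simp add: field_simps)
    then show False unfolding K_def by linarith
  qed
  then obtain j \<mu> where j: "j \<le> K" "(toppling_move lattice_adj ^^ j) (indicator {0}) \<mu>"
    "\<And>x. 0 \<le> \<mu> x" "p \<le> (\<Sum>x\<in>S - B. \<mu> x)"
    using lattice.greedy_toppling[OF finB finS BS nb _ ind avg_sqnorm sqnorm_nonneg p, of K] by auto
  have "ennreal p \<le> ennreal (\<Sum>x\<in>S - B. \<mu> x)" using j(4) by (rule ennreal_leI)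
  also have "\<dots> = (\<Sum>x\<in>S - B. ennreal (\<mu> x))" using j(3) by simp
  also have "\<dots> = (\<Sum>\<^sub>\<infinity>v\<in>S - B. ennreal (\<mu> v))" using finS by simp
  also have "\<dots> \<le> (\<Sum>\<^sub>\<infinity>v\<in>- B. ennreal (\<mu> v))"
    by (rule infsum_mono_neutral) (auto intro: nonneg_summable_on_complete)
  finally have "ennreal p \<le> (\<Sum>\<^sub>\<infinity>v\<in>- B. ennreal (\<mu> v))" .
  moreover have "real j \<le> real K" using j(1) by simp
  ultimately show ?thesis using j(2) K unfolding B_def by (intro exI[of _ j] exI[of _ \<mu>]) linarith
qed

lemma lattice_lower:
  fixes p :: real
  assumes p: "0 < p"
  shows "\<exists>c>0. \<forall>n\<ge>1. \<forall>k \<mu>. (toppling_move lattice_adj ^^ k) (indicator {0}) \<mu> \<longrightarrow>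
    ennreal p \<le> (\<Sum>\<^sub>\<infinity>v\<in>- graph_ball lattice_adj (0 :: int ^ 'd) n. ennreal (\<mu> v)) \<longrightarrow>
    c * real n ^ (CARD('d) + 2) \<le> real k"
proof -
  let ?d = "CARD('d)"
  \<comment> \<open>The second moment forces the odometer to have total at least p n^2 / d = 2 a
    n^2. The walk uses up at most a n^2 of it, and the other half must come from the term with
    \<open>k\<close>.\<close>
  define a where "a = p / (2 * ?d)"
  have a: "0 < a" using p by (simp add: a_def)
  obtain C where C: "0 < C" "\<And>n t (x :: int ^ 'd). 1 \<le> n \<Longrightarrow> a * (real n)\<^sup>2 \<le> real t + 1 \<Longrightarrow>
    lattice.walk 0 t x \<le> C / real n ^ ?d"
    using heat_kernel_bound[OF a] by metis
  have "a / (2 * C) * real n ^ (?d + 2) \<le> real k"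
    if n: "1 \<le> n" and moves: "(toppling_move lattice_adj ^^ k) (indicator {0}) \<mu>"
      and mass: "ennreal p \<le> (\<Sum>\<^sub>\<infinity>v\<in>- graph_ball lattice_adj (0 :: int ^ 'd) n. ennreal (\<mu> v))"
    for n k and \<mu> :: "int ^ 'd \<Rightarrow> real"
  proof -
    define t where "t = nat \<lfloor>a * (real n)\<^sup>2\<rfloor>"
    have t: "real t \<le> a * (real n)\<^sup>2" "a * (real n)\<^sup>2 \<le> real t + 1"
      using a by (simp_all add: t_def)
    define M where "M = C / real n ^ ?d"
    have M: "0 < M" using C n by (simp add: M_def)
    let ?B = "graph_ball lattice_adj (0 :: int ^ 'd) n"
    let ?w = "\<lambda>x :: int ^ 'd. \<Sum>s<t. lattice.walk 0 s x"
    obtain u where u: "lattice.odometer (indicator {0}) \<mu> u" "\<And>x. 0 \<le> \<mu> x"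
      "\<And>S. finite S \<Longrightarrow> {x. u x \<noteq> 0} \<subseteq> S \<Longrightarrow> (\<Sum>x\<in>S. u x) \<le> 2 * M * k + (\<Sum>x\<in>S. ?w x)"
    proof (rule lattice.odometer_excess_le[OF _ lattice.walk_telescope _ _ M moves])
      show "0 \<le> ?w x" for x by (intro sum_nonneg lattice.walk_nonneg)
      show "lattice.walk 0 t x \<le> M" for x :: "int ^ 'd" unfolding M_def by (rule C(2)[OF n t(2)])
    qed auto
    \<comment> \<open>Forcing the origin into \<open>S\<close> makes \<open>\<mu>\<close> vanish off
      \<open>S\<close>, so the infinite sum of the mass outside the ball is a finite one.\<close>
    obtain S where S: "finite S" "{0} \<subseteq> S" "{x. u x \<noteq> 0} \<subseteq> S"
      "\<And>x. x \<notin> S \<Longrightarrow> \<mu> x = indicator {0} x"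
      "(\<Sum>x\<in>S. sqnorm x * \<mu> x) = (\<Sum>x\<in>S. sqnorm x * indicator {0} x) + (\<Sum>x\<in>S. u x)"
      by (rule lattice.odometer_moment[OF u(1) avg_sqnorm, of "{0}"]) auto
    have "(\<Sum>x\<in>S. sqnorm x * indicator {0} x) = 0"
      by (rule sum.neutral) (auto simp: sqnorm_def indicator_def)
    then have moment: "(\<Sum>x\<in>S. sqnorm x * \<mu> x) = (\<Sum>x\<in>S. u x)" using S(5) by simp
    have "(\<Sum>\<^sub>\<infinity>v\<in>- ?B. ennreal (\<mu> v)) = (\<Sum>\<^sub>\<infinity>v\<in>S - ?B. ennreal (\<mu> v))"
    proof (rule infsum_cong_neutral)
      fix x assume "x \<in> - ?B - (S - ?B)"
      then have "x \<notin> S" by auto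
      moreover from this have "x \<noteq> 0" using S(2) by auto
      ultimately show "ennreal (\<mu> x) = 0" using S(4) by simp
    qed auto
    also have "\<dots> = ennreal (\<Sum>x\<in>S - ?B. \<mu> x)"
      using S(1) u(2) by simp
    finally have p_le: "p \<le> (\<Sum>x\<in>S - ?B. \<mu> x)"
      using mass u(2) by (simp add: ennreal_le_iff sum_nonneg)
    have far: "(real n)\<^sup>2 \<le> ?d * sqnorm x" if "x \<notin> ?B" for x :: "int ^ 'd"
    proof -
      have "real n \<le> real_of_int (l1 x)" using that by (simp add: graph_ball_lattice)
      then have "(real n)\<^sup>2 \<le> (real_of_int (l1 x))\<^sup>2" by (intro power_mono) auto
      then show ?thesis using l1_le_sqnorm[of x] by linarith
    qed
    have "p * (real n)\<^sup>2 \<le> (\<Sum>x\<in>S - ?B. \<mu> x) * (real n)\<^sup>2"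
      using p_le by (intro mult_right_mono) auto
    also have "\<dots> \<le> (\<Sum>x\<in>S - ?B. \<mu> x * (?d * sqnorm x))"
      unfolding sum_distrib_right by (intro sum_mono mult_left_mono far u(2)) auto
    also have "\<dots> \<le> (\<Sum>x\<in>S. \<mu> x * (?d * sqnorm x))"
      by (intro sum_mono2 S(1)) (auto intro!: mult_nonneg_nonneg u(2) sqnorm_nonneg)
    also have "\<dots> = ?d * (\<Sum>x\<in>S. u x)"
      unfolding moment[symmetric] sum_distrib_left by (intro sum.cong) auto
    finally have "2 * (a * (real n)\<^sup>2) \<le> (\<Sum>x\<in>S. u x)"
      by (simp add: a_def field_simps)
    also have "\<dots> \<le> 2 * M * k + (\<Sum>x\<in>S. ?w x)" by (rule u(3)[OF S(1,3)])
    also have "(\<Sum>x\<in>S. ?w x) \<le> t"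
    proof -
      have "(\<Sum>x\<in>S. ?w x) = (\<Sum>s<t. \<Sum>x\<in>S. lattice.walk 0 s x)" by (rule sum.swap)
      also have "\<dots> \<le> (\<Sum>s<t. 1)" by (intro sum_mono lattice.sum_walk_le S(1))
      finally show ?thesis by simp
    qed
    finally have "a * (real n)\<^sup>2 \<le> 2 * M * k" using t(1) by linarith
    \<comment> \<open>Since M = C / n^d, dividing by 2 M raises the exponent from 2 to d +
      2.\<close>
    then show ?thesis
      using C(1) n by (simp add: M_def power_add power2_eq_square field_simps)
  qed
  moreover have "0 < a / (2 * C)" using a C(1) by simp
  ultimately show ?thesis by blast
qed

theorem theorem1p2:
  fixes p :: real
  assumes "CARD('d::finite) \<ge> 2" and "0 < p" and "p < 1"
  shows "\<exists>(c::real) (C::real) (n0::nat). 0 < c \<and> c \<le> C \<and>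
    (\<forall>n\<ge>n0.
       ereal (c * real n ^ (CARD('d) + 2))
         \<le> ereal_of_enat (toppling_number p lattice_adj
              (graph_ball lattice_adj (0 :: int ^ 'd) n) (indicator {0})) \<and>
       ereal_of_enat (toppling_number p lattice_adj
              (graph_ball lattice_adj (0 :: int ^ 'd) n) (indicator {0}))
         \<le> ereal (C * real n ^ (CARD('d) + 2)))"
proof -
  let ?N = "\<lambda>n. toppling_number p lattice_adj (graph_ball lattice_adj (0 :: int ^ 'd) n) (indicator {0})"
  define X where "X n = {k. \<exists>\<mu>. (toppling_move lattice_adj ^^ k) (indicator {0}) \<mu> \<and>
    ennreal p \<le> (\<Sum>\<^sub>\<infinity>v\<in>- graph_ball lattice_adj (0 :: int ^ 'd) n. ennreal (\<mu> v))}" for n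
  have N: "?N n = (INF k\<in>X n. enat k)" for n
    by (simp add: toppling_number_def X_def)
  obtain c where c: "0 < c" "\<And>n k. 1 \<le> n \<Longrightarrow> k \<in> X n \<Longrightarrow> c * real n ^ (CARD('d) + 2) \<le> real k"
    using lattice_lower[OF assms(2), where 'd = 'd] unfolding X_def by blast
  define C where "C = 3 ^ CARD('d) / (1 - p) + 1"
  have upper: "\<exists>j\<in>X n. real j \<le> C * real n ^ (CARD('d) + 2)" if "1 \<le> n" for n
    using lattice_upper[OF assms(3) that, where 'd = 'd] unfolding X_def C_def by blast
  \<comment> \<open>The upper bound shows that \<open>X n\<close> is nonempty, so the infimum is a
    finite number attained in \<open>X n\<close>.\<close>
  have attained: "\<exists>k\<in>X n. ?N n = enat k" if n: "1 \<le> n" for n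
  proof -
    obtain j where "j \<in> X n" using upper[OF n] by blast
    then have "?N n \<in> enat ` X n"
      unfolding N by (intro wellorder_InfI[of "enat j"]) auto
    then show ?thesis by auto
  qed
  \<comment> \<open>At \<open>n = 1\<close> both powers are 1, and a number of moves lies between
    the two constants.\<close>
  have "c \<le> C"
    using upper[of 1] c(2)[of 1] by force
  moreover have "ereal (c * real n ^ (CARD('d) + 2)) \<le> ereal_of_enat (?N n)"
    "ereal_of_enat (?N n) \<le> ereal (C * real n ^ (CARD('d) + 2))" if n: "1 \<le> n" for n
  proof -
    obtain k where k: "k \<in> X n" "?N n = enat k" using attained[OF n] by blast
    then show "ereal (c * real n ^ (CARD('d) + 2)) \<le> ereal_of_enat (?N n)"
      using c(2)[OF n k(1)] by simp
    obtain j where j: "j \<in> X n" "real j \<le> C * real n ^ (CARD('d) + 2)" using upper[OF n] by blast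
    have "?N n \<le> enat j" unfolding N using j(1) by (rule INF_lower)
    then show "ereal_of_enat (?N n) \<le> ereal (C * real n ^ (CARD('d) + 2))"
      using j(2) k(2) by simp
  qed
  ultimately show ?thesis using c(1) by (intro exI[of _ c] exI[of _ C] exI[of _ 1]) auto
qed

end
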